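(* For every bipartite graph $G$, $F_G(z)=F_{G^*}(z)$, where $F_G(z)=\sum_{\boldsymbol a\in D(G)}z^{s(\boldsymbol a)}$ is the support-enumerator of $G$, and $G^*$ is the bipartite graph obtained from $G$ by swapping its left and right vertex sets.
   Context: A bipartite graph $G$ comes with an ordered bipartition into left vertices $\ell_1,\dots,\ell_m$ and right vertices $r_1,\dots,r_n$. For $j\in[m]=\{1,\dots,m\}$, $I_j=\{i\in[n]\mid\ell_j\text{ is adjacent to }r_i\}$. A $G$-draconian sequence is a sequence $(a_1,\dots,a_m)$ of nonnegative integers such that $\sum_{i\in J}a_i\le|\bigcup_{i\in J}I_i|$ for every nonempty $J\subset[m]$; $D(G)$ is the set of all of them. (Thus $D(G)\subset\mathbb Z_{\ge0}^m$ and $D(G^* )\subset\mathbb Z_{\ge0}^n$.) $s(\boldsymbol a)$ denotes the number of positive coordinates of $\boldsymbol a$. *)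

theory Defs
  imports "HOL-Library.FuncSet" "HOL-Computational_Algebra.Polynomial"
begin

text \<open>
  The left vertices are indexed by \<open>{1..num_left G}\<close>, the right vertices by
  \<open>{1..num_right G}\<close>; a pair \<open>(j, i)\<close> in \<open>edges G\<close> means that the \<open>j\<close>-th left
  vertex is adjacent to the \<open>i\<close>-th right vertex. Isolated vertices and empty
  sides are allowed.
\<close>

record bigraph =
  num_left :: nat
  num_right :: nat
  edges :: "(nat \<times> nat) set"

definition bipartite_graph :: "bigraph \<Rightarrow> bool" where
  "bipartite_graph G \<longleftrightarrow> edges G \<subseteq> {1..num_left G} \<times> {1..num_right G}"

definition dual_graph :: "bigraph \<Rightarrow> bigraph" where
  "dual_graph G = \<lparr>num_left = num_right G, num_right = num_left G, edges = (edges G)\<inverse>\<rparr>"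

definition right_nbrs :: "bigraph \<Rightarrow> nat \<Rightarrow> nat set" where
  "right_nbrs G j = {i \<in> {1..num_right G}. (j, i) \<in> edges G}"

text \<open>
  A sequence \<open>(a\<^sub>1, \<dots>, a\<^sub>m)\<close> is an extensional function on \<open>{1..m}\<close>, so that
  distinct functions represent distinct sequences.
\<close>

definition draconian :: "bigraph \<Rightarrow> (nat \<Rightarrow> nat) set" where
  "draconian G =
    {a \<in> {1..num_left G} \<rightarrow>\<^sub>E UNIV.
      \<forall>J. J \<noteq> {} \<and> J \<subseteq> {1..num_left G} \<longrightarrow>
        (\<Sum>i\<in>J. a i) \<le> card (\<Union>i\<in>J. right_nbrs G i)}"

definition num_positive :: "nat \<Rightarrow> (nat \<Rightarrow> nat) \<Rightarrow> nat" where
  "num_positive m a = card {i \<in> {1..m}. a i > 0}"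

definition support_enumerator :: "bigraph \<Rightarrow> int poly" where
  "support_enumerator G = (\<Sum>a\<in>draconian G. monom 1 (num_positive (num_left G) a))"

text \<open>The index set of the sum above is finite, so the sum is never degenerate.\<close>

lemma finite_draconian: "finite (draconian G)"
proof (rule finite_subset)
  show "draconian G \<subseteq> {1..num_left G} \<rightarrow>\<^sub>E {..num_right G}"
  proof
    fix a assume a: "a \<in> draconian G"
    have "a i \<le> num_right G" if i: "i \<in> {1..num_left G}" for i
    proof -
      have "(\<Sum>k\<in>{i}. a k) \<le> card (\<Union>k\<in>{i}. right_nbrs G k)"
        using a i unfolding draconian_def by blast
      then have "a i \<le> card (right_nbrs G i)" by simp
      also have "\<dots> \<le> card {1..num_right G}"
        by (rule card_mono) (auto simp: right_nbrs_def)
      finally show ?thesis by simp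
    qed
    then show "a \<in> {1..num_left G} \<rightarrow>\<^sub>E {..num_right G}"
      using a unfolding draconian_def by (auto simp: PiE_iff)
  qed
  show "finite ({1..num_left G} \<rightarrow>\<^sub>E {..num_right G})"
    by (rule finite_PiE) auto
qed

end

theory Submission imports Defs begin

text \<open>
  The coefficient of \<open>z\<^sup>k\<close> counts the pairs \<open>(S, T)\<close> of \<open>k\<close>-sets of left and right vertices that
  are joined by a perfect matching, which is visibly symmetric. More precisely, for a fixed set
  \<open>S\<close> of left vertices the draconian sequences with support \<open>S\<close> are equinumerous with the sets
  \<open>T\<close> perfectly matched to \<open>S\<close>: both counts satisfy the same recursion when an edge \<open>jr\<close> is
  deleted. An object lost by the deletion has a tight set (equality in Hall's condition)
  \<open>J \<ni> j\<close> in which \<open>r\<close> is adjacent to \<open>j\<close> only. By submodularity there is a least such \<open>J\<close>, and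
  the object splits into a part on \<open>J\<close> and a part on \<open>S - J\<close> in the graph with the neighbours
  of \<open>J\<close> removed. The number \<open>\<alpha>(J)\<close> of possible parts on \<open>J\<close> depends on the graph induced on \<open>J\<close>
  alone, where \<open>r\<close> is a leaf; there deleting \<open>jr\<close> loses exactly as many objects as there are on
  \<open>J - {j}\<close>, so that \<open>\<alpha>\<close> is determined by smaller counts.
\<close>

section \<open>Counts determined by edge deletion\<close>

definition del_edge :: "('a \<Rightarrow> 'b set) \<Rightarrow> 'a \<Rightarrow> 'b \<Rightarrow> 'a \<Rightarrow> 'b set" where
  "del_edge N j r = N(j := N j - {r})"

text \<open>Meant for indices outside \<open>J\<close>: a tight \<open>J\<close> uses up all its
  neighbours, and the other indices must manage with what remains. On \<open>J\<close> itself the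
  result is empty.\<close>

definition contract :: "('a \<Rightarrow> 'b set) \<Rightarrow> 'a set \<Rightarrow> 'a \<Rightarrow> 'b set" where
  "contract N J i = N i - \<Union>(N ` J)"

text \<open>The essential feature of \<open>split\<close> is that the weight \<open>\<alpha>\<close>
  does not take \<open>S\<close> as an argument. The same weights occur when \<open>split\<close> is
  applied to a subset \<open>J\<close> in place of \<open>S\<close>, and this makes them computable
  from smaller counts.\<close>

locale edge_recursive =
  fixes q :: "'a set \<Rightarrow> ('a \<Rightarrow> 'b set) \<Rightarrow> nat"
    and \<alpha> :: "('a \<Rightarrow> 'b set) \<Rightarrow> 'a \<Rightarrow> 'b \<Rightarrow> 'a set \<Rightarrow> nat"
  assumes empty: "q {} N = 1"
    and isolated: "\<lbrakk>finite S; i \<in> S; N i = {}\<rbrakk> \<Longrightarrow> q S N = 0"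
    and pendant: "\<lbrakk>finite S; \<And>i. i \<in> S \<Longrightarrow> finite (N i); j \<in> S; r \<in> N j; r \<notin> \<Union>(N ` (S - {j}))\<rbrakk>
      \<Longrightarrow> q S N = q S (del_edge N j r) + q (S - {j}) N"
    and split: "\<lbrakk>finite S; \<And>i. i \<in> S \<Longrightarrow> finite (N i); j \<in> S; r \<in> N j\<rbrakk>
      \<Longrightarrow> q S N = q S (del_edge N j r) +
        (\<Sum>J | J \<subseteq> S \<and> j \<in> J \<and> r \<notin> \<Union>(N ` (J - {j})). \<alpha> N j r J * q (S - J) (contract N J))"

text \<open>Induction on the number of edges leaving \<open>S\<close>. If some edge
  \<open>jr\<close> has \<open>r\<close> adjacent to \<open>j\<close> only, \<open>pendant\<close>
  reduces to fewer edges without any weights. Otherwise \<open>split\<close> is used, once the two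
  families of weights are known to agree. Nothing is assumed to relate \<open>\<alpha>\<close> and
  \<open>\<alpha>'\<close>; their agreement is part of the induction.\<close>

lemma edge_recursive_unique:
  assumes q: "edge_recursive q \<alpha>" and q': "edge_recursive q' \<alpha>'"
    and "finite S" "\<And>i. i \<in> S \<Longrightarrow> finite (N i)"
  shows "q S N = q' S N"
  using assms(3,4)
proof (induction "card (Sigma S N)" arbitrary: S N rule: less_induct)
  case less
  note fin = less.prems
  have finSig: "finite (Sigma S N)" using fin by auto
  have IH: "q S' N' = q' S' N'" if "Sigma S' N' \<subset> Sigma S N" "S' \<subseteq> S" "\<And>i. i \<in> S' \<Longrightarrow> N' i \<subseteq> N i" for S' N'
  proof (rule less.hyps)
    show "card (Sigma S' N') < card (Sigma S N)" using that(1) finSig by (rule psubset_card_mono[rotated])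
    show "finite S'" using that(2) fin(1) by (rule finite_subset)
    show "finite (N' i)" if "i \<in> S'" for i
      using that \<open>S' \<subseteq> S\<close> \<open>\<And>i. i \<in> S' \<Longrightarrow> N' i \<subseteq> N i\<close>[of i] fin(2)[of i] finite_subset by blast
  qed
  show ?case
  proof (cases "S = {} \<or> (\<exists>i\<in>S. N i = {})")
    case True
    then show ?thesis
      using edge_recursive.empty[OF q] edge_recursive.empty[OF q'] 
        edge_recursive.isolated[OF q fin(1)] edge_recursive.isolated[OF q' fin(1)] by metis
  next
    case False
    then obtain j r where j: "j \<in> S" and r: "r \<in> N j" by blast
    have del: "q S (del_edge N j r) = q' S (del_edge N j r)"
    proof (rule IH)
      show "Sigma S (del_edge N j r) \<subset> Sigma S N"
        using j r by (intro psubsetI) (auto simp: del_edge_def set_eq_iff split: if_splits)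
    qed (auto simp: del_edge_def split: if_splits)
    show ?thesis
    proof (cases "r \<in> \<Union>(N ` (S - {j}))")
      case False
      have "q (S - {j}) N = q' (S - {j}) N"
        using j r by (intro IH) auto
      with del show ?thesis
        using edge_recursive.pendant[OF q fin j r False] edge_recursive.pendant[OF q' fin j r False] by simp
    next
      case True
      \<comment> \<open>A second neighbour \<open>x\<close> of \<open>r\<close> lies outside every
        index set \<open>J\<close> of the sum, so the graph on \<open>J\<close> lacks the edge
        \<open>xr\<close> and the induction hypothesis covers the counts on \<open>J\<close> as
        well.\<close>
      then obtain x where x: "x \<in> S" "x \<noteq> j" "r \<in> N x" by blast
      have contr: "q (J - J') (contract N J') = q' (J - J') (contract N J')"
        if "j \<in> J'" "J' \<subseteq> J" "J \<subseteq> S" for J J'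
      proof (rule IH)
        show "Sigma (J - J') (contract N J') \<subset> Sigma S N"
          using that j r by (auto simp: contract_def)
      qed (use that in \<open>auto simp: contract_def\<close>)
      \<comment> \<open>The identity \<open>split\<close> with \<open>J\<close> in the role of
        \<open>S\<close> is solved for the weight of \<open>J\<close>. All its other terms already
        agree: the counts by the outer induction, the weights of proper subsets by the inner
        one.\<close>
      have \<alpha>: "\<alpha> N j r J = \<alpha>' N j r J"
        if "J \<subseteq> S" "j \<in> J" "r \<notin> \<Union>(N ` (J - {j}))" for J
        using finite_subset[OF that(1) fin(1)] that
      proof (induction J rule: finite_psubset_induct)
        case (psubset J)
        have finJ: "finite (N i)" if "i \<in> J" for i using that psubset.prems fin by auto
        have xJ: "x \<notin> J" using x psubset.prems by auto
        let ?I = "{J'. J' \<subseteq> J \<and> j \<in> J' \<and> r \<notin> \<Union>(N ` (J' - {j}))}"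
        have I: "finite ?I" "J \<in> ?I" using psubset by auto
        have "q J N = q' J N"
          using xJ x psubset.prems by (intro IH) auto
        moreover have "q J (del_edge N j r) = q' J (del_edge N j r)"
        proof (rule IH)
          show "Sigma J (del_edge N j r) \<subset> Sigma S N"
            using x xJ psubset.prems by (auto simp: del_edge_def split: if_splits)
        qed (use psubset.prems in \<open>auto simp: del_edge_def split: if_splits\<close>)
        moreover have "(\<Sum>J'\<in>?I - {J}. \<alpha> N j r J' * q (J - J') (contract N J'))
            = (\<Sum>J'\<in>?I - {J}. \<alpha>' N j r J' * q' (J - J') (contract N J'))"
        proof (rule sum.cong)
          fix J' assume J': "J' \<in> ?I - {J}"
          then have "\<alpha> N j r J' = \<alpha>' N j r J'" using psubset.prems by (intro psubset.IH) auto
          with J' show "\<alpha> N j r J' * q (J - J') (contract N J') = \<alpha>' N j r J' * q' (J - J') (contract N J')"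
            using contr[of J' J] psubset.prems by simp
        qed simp
        \<comment> \<open>The summand for \<open>J' = J\<close> carries the factor
          \<open>q {}\<close>, which is \<open>1\<close>, so the unknown weight stands alone and
          cancellation applies.\<close>
        ultimately show ?case
          using edge_recursive.split[where S = J and N = N and j = j and r = r, OF q psubset.hyps finJ psubset.prems(2) r]
            edge_recursive.split[where S = J and N = N and j = j and r = r, OF q' psubset.hyps finJ psubset.prems(2) r]
            sum.remove[OF I, of "\<lambda>J'. \<alpha> N j r J' * q (J - J') (contract N J')"]
            sum.remove[OF I, of "\<lambda>J'. \<alpha>' N j r J' * q' (J - J') (contract N J')"]
          unfolding Diff_cancel edge_recursive.empty[OF q] edge_recursive.empty[OF q'] mult_1_right
          by linarith
      qed
      have "(\<Sum>J | J \<subseteq> S \<and> j \<in> J \<and> r \<notin> \<Union>(N ` (J - {j})). \<alpha> N j r J * q (S - J) (contract N J))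
          = (\<Sum>J | J \<subseteq> S \<and> j \<in> J \<and> r \<notin> \<Union>(N ` (J - {j})). \<alpha>' N j r J * q' (S - J) (contract N J))"
        by (rule sum.cong) (use \<alpha> contr in auto)
      with del show ?thesis
        using edge_recursive.split[where N = N, OF q fin j r] edge_recursive.split[where N = N, OF q' fin j r] by simp
    qed
  qed
qed

lemma finite_nbhd:
  assumes "finite S" "\<And>i. i \<in> S \<Longrightarrow> finite (N i)" "J \<subseteq> S"
  shows "finite (\<Union>(N ` J))"
  using assms finite_subset by blast

section \<open>Hall's condition and tight sets\<close>

text \<open>Two uses share this form: with \<open>T = UNIV\<close> it is the draconian inequality
  for \<open>a\<close>; with \<open>a\<close> constantly \<open>1\<close> it is the marriage
  condition for matching \<open>S\<close> into \<open>T\<close>.\<close>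

definition hall :: "('a \<Rightarrow> 'b set) \<Rightarrow> ('a \<Rightarrow> nat) \<Rightarrow> 'b set \<Rightarrow> 'a set \<Rightarrow> bool" where
  "hall N a T S \<longleftrightarrow> (\<forall>J\<subseteq>S. sum a J \<le> card (\<Union>(N ` J) \<inter> T))"

definition tight :: "('a \<Rightarrow> 'b set) \<Rightarrow> ('a \<Rightarrow> nat) \<Rightarrow> 'b set \<Rightarrow> 'a set \<Rightarrow> bool" where
  "tight N a T J \<longleftrightarrow> sum a J = card (\<Union>(N ` J) \<inter> T)"

definition min_tight :: "('a \<Rightarrow> 'b set) \<Rightarrow> ('a \<Rightarrow> nat) \<Rightarrow> 'b set \<Rightarrow> 'a \<Rightarrow> 'a set \<Rightarrow> bool" where
  "min_tight N a T j J \<longleftrightarrow> j \<in> J \<and> tight N a T J \<and> (\<forall>J'\<subset>J. j \<in> J' \<longrightarrow> \<not> tight N a T J')"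

lemma hall_cong:
  assumes "\<And>i. i \<in> S \<Longrightarrow> a i = a' i" "\<And>i. i \<in> S \<Longrightarrow> N i \<inter> T = N' i \<inter> T'"
  shows "hall N a T S \<longleftrightarrow> hall N' a' T' S"
proof -
  have "sum a J = sum a' J" "\<Union>(N ` J) \<inter> T = \<Union>(N' ` J) \<inter> T'" if "J \<subseteq> S" for J
  proof -
    show "sum a J = sum a' J" using that assms(1) by (intro sum.cong) auto
    have "(\<Union>i\<in>J. N i \<inter> T) = (\<Union>i\<in>J. N' i \<inter> T')" using that assms(2) by (intro SUP_cong) auto
    then show "\<Union>(N ` J) \<inter> T = \<Union>(N' ` J) \<inter> T'" by simp
  qed
  then show ?thesis unfolding hall_def by simp
qed

lemma tight_cong:
  assumes "\<And>i. i \<in> J \<Longrightarrow> a i = a' i" "\<And>i. i \<in> J \<Longrightarrow> N i \<inter> T = N i \<inter> T'"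
  shows "tight N a T J \<longleftrightarrow> tight N a' T' J"
proof -
  have "sum a J = sum a' J" using assms by (auto intro!: sum.cong)
  moreover have "\<Union>(N ` J) \<inter> T = \<Union>(N ` J) \<inter> T'" using assms by auto
  ultimately show ?thesis by (simp add: tight_def)
qed

lemma min_tight_cong:
  assumes "\<And>i. i \<in> J \<Longrightarrow> a i = a' i" "\<And>i. i \<in> J \<Longrightarrow> N i \<inter> T = N i \<inter> T'"
  shows "min_tight N a T j J \<longleftrightarrow> min_tight N a' T' j J"
proof -
  have "tight N a T K \<longleftrightarrow> tight N a' T' K" if "K \<subseteq> J" for K
    using that assms by (intro tight_cong) auto
  then show ?thesis unfolding min_tight_def by auto
qed

lemma hall_subset: "hall N a T S \<Longrightarrow> S' \<subseteq> S \<Longrightarrow> hall N a T S'"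
  by (auto simp: hall_def)

lemma ex_min_tight:
  assumes "finite J" "j \<in> J" "tight N a T J"
  shows "\<exists>J'\<subseteq>J. min_tight N a T j J'"
  using assms
proof (induction J rule: finite_psubset_induct)
  case (psubset J)
  show ?case
  proof (cases "min_tight N a T j J")
    case False
    with psubset.prems obtain K where "K \<subset> J" "j \<in> K" "tight N a T K"
      by (auto simp: min_tight_def)
    with psubset.IH[of K] show ?thesis by blast
  qed auto
qed

text \<open>The number of neighbours in \<open>T\<close> is submodular in the index set, while
  \<open>sum a\<close> is modular. Equality at \<open>J\<close> and \<open>K\<close> therefore
  leaves no slack in Hall's inequality at their union and intersection.\<close>

lemma tight_Int:
  assumes "finite S" "\<And>i. i \<in> S \<Longrightarrow> finite (N i)" "hall N a T S"
    and J: "J \<subseteq> S" "tight N a T J" and K: "K \<subseteq> S" "tight N a T K"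
  shows "tight N a T (J \<inter> K)"
proof -
  let ?c = "\<lambda>J. card (\<Union>(N ` J) \<inter> T)"
  have fJK: "finite J" "finite K" using assms finite_subset by blast+
  have fin: "finite (\<Union>(N ` J) \<inter> T)" "finite (\<Union>(N ` K) \<inter> T)"
    using finite_nbhd[OF assms(1,2)] J K by auto
  have "?c (J \<union> K) = card ((\<Union>(N ` J) \<inter> T) \<union> (\<Union>(N ` K) \<inter> T))"
    by (rule arg_cong[where f = card]) auto
  moreover have "?c (J \<inter> K) \<le> card ((\<Union>(N ` J) \<inter> T) \<inter> (\<Union>(N ` K) \<inter> T))"
    by (rule card_mono) (use fin in auto)
  ultimately have "?c (J \<union> K) + ?c (J \<inter> K) \<le> ?c J + ?c K"
    using card_Un_Int[OF fin] by linarith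
  moreover have "sum a (J \<union> K) + sum a (J \<inter> K) = sum a J + sum a K"
    by (rule sum.union_inter) (use fJK in auto)
  moreover have "sum a (J \<union> K) \<le> ?c (J \<union> K)" "sum a (J \<inter> K) \<le> ?c (J \<inter> K)"
    using assms(3) J K unfolding hall_def by (meson Un_least le_infI1)+
  ultimately show ?thesis using J K unfolding tight_def by linarith
qed

lemma min_tight_unique:
  assumes "finite S" "\<And>i. i \<in> S \<Longrightarrow> finite (N i)" "hall N a T S"
    and J: "J \<subseteq> S" "min_tight N a T j J" and K: "K \<subseteq> S" "min_tight N a T j K"
  shows "J = K"
proof -
  have "tight N a T (J \<inter> K)"
    using J K by (intro tight_Int[OF assms(1-3)]) (auto simp: min_tight_def)
  moreover have "j \<in> J \<inter> K" using J K by (auto simp: min_tight_def)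
  ultimately have "J \<inter> K = J" "J \<inter> K = K"
    using J K unfolding min_tight_def by (metis inf_le1 inf_le2 psubsetI)+
  then show ?thesis by simp
qed

section \<open>Hall's condition under edge deletion and contraction\<close>

lemma Union_del_edge:
  "\<Union>(del_edge N j r ` J) = (if j \<in> J \<and> r \<notin> \<Union>(N ` (J - {j})) then \<Union>(N ` J) - {r} else \<Union>(N ` J))"
  by (auto simp: del_edge_def split: if_splits)

lemma hall_del_edge_imp:
  assumes "\<And>i. i \<in> S \<Longrightarrow> finite (N i)" "finite S" "hall (del_edge N j r) a T S"
  shows "hall N a T S"
  unfolding hall_def
proof (intro allI impI)
  fix J assume J: "J \<subseteq> S"
  then have "sum a J \<le> card (\<Union>(del_edge N j r ` J) \<inter> T)" using assms by (auto simp: hall_def)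
  also have "\<dots> \<le> card (\<Union>(N ` J) \<inter> T)"
    using finite_subset[OF J] assms J by (intro card_mono) (auto simp: Union_del_edge split: if_splits)
  finally show "sum a J \<le> card (\<Union>(N ` J) \<inter> T)" .
qed

text \<open>Deleting \<open>jr\<close> shrinks the neighbourhood of \<open>J\<close> within
  \<open>T\<close> by at most one element, namely \<open>r\<close>, and only if \<open>r\<close> is
  in \<open>T\<close> and reached from \<open>J\<close> through \<open>j\<close> alone. An
  inequality broken by the deletion was thus an equality before.\<close>

lemma not_hall_del_edge_iff:
  assumes "finite S" "\<And>i. i \<in> S \<Longrightarrow> finite (N i)" "hall N a T S" "r \<in> N j"
  shows "\<not> hall (del_edge N j r) a T S \<longleftrightarrow>
    r \<in> T \<and> (\<exists>J\<subseteq>S. r \<notin> \<Union>(N ` (J - {j})) \<and> min_tight N a T j J)"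
proof
  assume "\<not> hall (del_edge N j r) a T S"
  then obtain J where J: "J \<subseteq> S" "\<not> sum a J \<le> card (\<Union>(del_edge N j r ` J) \<inter> T)"
    by (auto simp: hall_def)
  have fin: "finite (\<Union>(N ` J) \<inter> T)" using finite_nbhd[OF assms(1,2)] J by auto
  have le: "sum a J \<le> card (\<Union>(N ` J) \<inter> T)" using assms J by (auto simp: hall_def)
  from J(2) le have *: "j \<in> J" "r \<notin> \<Union>(N ` (J - {j}))" by (auto simp: Union_del_edge split: if_splits)
  then have "\<Union>(del_edge N j r ` J) \<inter> T = (\<Union>(N ` J) \<inter> T) - {r}" by (auto simp: Union_del_edge)
  with J le have rT: "r \<in> T" by (cases "r \<in> T") auto
  have "r \<in> \<Union>(N ` J) \<inter> T" using * rT assms by auto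
  then have "card ((\<Union>(N ` J) \<inter> T) - {r}) = card (\<Union>(N ` J) \<inter> T) - 1" by simp
  with \<open>\<Union>(del_edge N j r ` J) \<inter> T = _\<close> J le have "tight N a T J" by (simp add: tight_def)
  \<comment> \<open>Passing to a minimal tight subset is harmless: that \<open>r\<close> is reached
    through \<open>j\<close> alone is inherited by subsets.\<close>
  then obtain J' where J': "J' \<subseteq> J" "min_tight N a T j J'"
    using ex_min_tight[OF finite_subset[OF J(1) assms(1)] *(1)] by blast
  have "r \<notin> \<Union>(N ` (J' - {j}))" using J'(1) *(2) by auto
  then show "r \<in> T \<and> (\<exists>J\<subseteq>S. r \<notin> \<Union>(N ` (J - {j})) \<and> min_tight N a T j J)"
    using J(1) J' rT by (intro conjI exI[of _ J']) auto
next
  assume "r \<in> T \<and> (\<exists>J\<subseteq>S. r \<notin> \<Union>(N ` (J - {j})) \<and> min_tight N a T j J)"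
  then obtain J where J: "r \<in> T" "J \<subseteq> S" "r \<notin> \<Union>(N ` (J - {j}))" "min_tight N a T j J" by blast
  have fin: "finite (\<Union>(N ` J) \<inter> T)" using finite_nbhd[OF assms(1,2)] J by auto
  have "\<Union>(del_edge N j r ` J) \<inter> T = (\<Union>(N ` J) \<inter> T) - {r}"
    using J by (auto simp: Union_del_edge min_tight_def)
  moreover have "r \<in> \<Union>(N ` J) \<inter> T" using J assms by (auto simp: min_tight_def)
  ultimately have "card (\<Union>(del_edge N j r ` J) \<inter> T) < card (\<Union>(N ` J) \<inter> T)"
    using fin by (metis card_Diff1_less)
  then show "\<not> hall (del_edge N j r) a T S"
    using J unfolding hall_def min_tight_def tight_def by (metis not_le)
qed

text \<open>Forwards, the inequality for \<open>K \<union> J\<close> minus the equality for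
  \<open>J\<close> is the contracted inequality for \<open>K\<close>. Backwards, the inequalities
  for \<open>L \<inter> J\<close> and \<open>L - J\<close> add up, because contracted neighbourhoods
  avoid the neighbours of \<open>J\<close>.\<close>

lemma hall_contract_iff:
  assumes "finite S" "\<And>i. i \<in> S \<Longrightarrow> finite (N i)" "J \<subseteq> S" "tight N a T J"
  shows "hall N a T S \<longleftrightarrow> hall N a T J \<and> hall (contract N J) a T (S - J)"
proof
  assume hall: "hall N a T S"
  have "hall (contract N J) a T (S - J)"
    unfolding hall_def
  proof (intro allI impI)
    fix K assume K: "K \<subseteq> S - J"
    then have fK: "finite K" "finite J" using assms finite_subset by blast+
    have fin: "finite (\<Union>(contract N J ` K) \<inter> T)" "finite (\<Union>(N ` J) \<inter> T)"
      using finite_nbhd[where N = N, OF assms(1,2) subset_refl] K assms(3)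
      by (auto simp: contract_def elim!: rev_finite_subset)
    have "sum a K + sum a J = sum a (K \<union> J)"
      using K fK by (subst sum.union_disjoint) auto
    also have "\<dots> \<le> card (\<Union>(N ` (K \<union> J)) \<inter> T)"
      using hall K assms(3) unfolding hall_def by (meson Diff_subset Un_least order_trans)
    also have "\<Union>(N ` (K \<union> J)) \<inter> T = (\<Union>(contract N J ` K) \<inter> T) \<union> (\<Union>(N ` J) \<inter> T)"
      by (auto simp: contract_def)
    also have "card \<dots> = card (\<Union>(contract N J ` K) \<inter> T) + card (\<Union>(N ` J) \<inter> T)"
      using fin by (intro card_Un_disjoint) (auto simp: contract_def)
    finally show "sum a K \<le> card (\<Union>(contract N J ` K) \<inter> T)"
      using assms(4) by (simp add: tight_def)
  qed
  with hall assms show "hall N a T J \<and> hall (contract N J) a T (S - J)"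
    using hall_subset by blast
next
  assume h: "hall N a T J \<and> hall (contract N J) a T (S - J)"
  show "hall N a T S"
    unfolding hall_def
  proof (intro allI impI)
    fix L assume L: "L \<subseteq> S"
    have fL: "finite L" using L assms finite_subset by blast
    have fin: "finite (\<Union>(N ` L) \<inter> T)" using finite_nbhd[OF assms(1,2) L] by simp
    have "sum a L = sum a (L \<inter> J) + sum a (L - J)" using fL by (simp add: sum.Int_Diff)
    also have "\<dots> \<le> card (\<Union>(N ` (L \<inter> J)) \<inter> T) + card (\<Union>(contract N J ` (L - J)) \<inter> T)"
    proof (rule add_mono)
      show "sum a (L \<inter> J) \<le> card (\<Union>(N ` (L \<inter> J)) \<inter> T)"
        using h unfolding hall_def by simp
      show "sum a (L - J) \<le> card (\<Union>(contract N J ` (L - J)) \<inter> T)"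
        using h Diff_mono[OF L subset_refl] unfolding hall_def by simp
    qed
    also have "\<dots> = card ((\<Union>(N ` (L \<inter> J)) \<inter> T) \<union> (\<Union>(contract N J ` (L - J)) \<inter> T))"
      using fin by (intro card_Un_disjoint[symmetric]) (auto simp: contract_def elim: rev_finite_subset)
    also have "\<dots> \<le> card (\<Union>(N ` L) \<inter> T)"
      using fin by (intro card_mono) (auto simp: contract_def)
    finally show "sum a L \<le> card (\<Union>(N ` L) \<inter> T)" .
  qed
qed

section \<open>Draconian sequences with prescribed support\<close>

text \<open>Functions vanishing outside \<open>S\<close>, rather than extensional ones, so that lowering a value
  to \<open>0\<close> removes an index from the support.\<close>

definition pos_draconian :: "'a set \<Rightarrow> ('a \<Rightarrow> 'b set) \<Rightarrow> ('a \<Rightarrow> nat) set" where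
  "pos_draconian S N = {a. {i. 0 < a i} = S \<and> hall N a UNIV S}"

text \<open>By Hall's theorem these are the sets perfectly matched to \<open>S\<close>.\<close>

definition matchable :: "'a set \<Rightarrow> ('a \<Rightarrow> 'b set) \<Rightarrow> 'b set set" where
  "matchable S N = {T. T \<subseteq> \<Union>(N ` S) \<and> card T = card S \<and> hall N (\<lambda>_. 1) T S}"

section \<open>The two recursions for draconian sequences\<close>

lemma pos_draconianD:
  assumes "a \<in> pos_draconian S N"
  shows "{i. 0 < a i} = S" "hall N a UNIV S" "i \<notin> S \<Longrightarrow> a i = 0"
proof -
  show supp: "{i. 0 < a i} = S" and "hall N a UNIV S"
    using assms by (simp_all add: pos_draconian_def)
  show "i \<notin> S \<Longrightarrow> a i = 0" using supp by auto
qed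

lemma finite_matchable:
  assumes "finite S" "\<And>i. i \<in> S \<Longrightarrow> finite (N i)"
  shows "finite (matchable S N)"
  by (rule finite_subset[of _ "Pow (\<Union>(N ` S))"]) (use assms in \<open>auto simp: matchable_def\<close>)

lemma finite_pos_draconian:
  assumes "finite S" "\<And>i. i \<in> S \<Longrightarrow> finite (N i)"
  shows "finite (pos_draconian S N)"
proof (rule finite_subset)
  show "pos_draconian S N \<subseteq> {a. a \<in> S \<rightarrow> {..card (\<Union>(N ` S))} \<and> (\<forall>i. i \<notin> S \<longrightarrow> a i = 0)}"
  proof
    fix a assume "a \<in> pos_draconian S N"
    then have a: "{i. 0 < a i} = S" "hall N a UNIV S" by (auto simp: pos_draconian_def)
    have "a i \<le> card (\<Union>(N ` S))" if "i \<in> S" for i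
    proof -
      have "a i \<le> sum a S" using that assms(1) by (simp add: member_le_sum)
      also have "\<dots> \<le> card (\<Union>(N ` S))" using a by (auto simp: hall_def)
      finally show ?thesis .
    qed
    then show "a \<in> {a. a \<in> S \<rightarrow> {..card (\<Union>(N ` S))} \<and> (\<forall>i. i \<notin> S \<longrightarrow> a i = 0)}" using a by auto
  qed
  show "finite {a. a \<in> S \<rightarrow> {..card (\<Union>(N ` S))} \<and> (\<forall>i. i \<notin> S \<longrightarrow> a i = (0::nat))}"
    using finite_set_of_finite_funs[OF assms(1), of "{..card (\<Union>(N ` S))}" 0]
    by (rule back_subst[where P = finite]) (auto simp: Pi_iff)
qed

text \<open>For \<open>J\<close> containing \<open>j\<close>, both sides of the inequality drop by
  exactly one, since \<open>r\<close> is counted only through \<open>j\<close>. For other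
  \<open>J\<close> neither side changes.\<close>

lemma hall_pendant_Suc_iff:
  assumes "finite S" "\<And>i. i \<in> S \<Longrightarrow> finite (N i)" "j \<in> S" "r \<in> N j" "r \<notin> \<Union>(N ` (S - {j}))"
  shows "hall N (a(j := Suc v)) UNIV S \<longleftrightarrow> hall (del_edge N j r) (a(j := v)) UNIV S"
proof -
  have "sum (a(j := Suc v)) J \<le> card (\<Union>(N ` J)) \<longleftrightarrow> sum (a(j := v)) J \<le> card (\<Union>(del_edge N j r ` J))"
    if J: "J \<subseteq> S" for J
  proof (cases "j \<in> J")
    case True
    have fJ: "finite J" using J assms finite_subset by blast
    have "finite (\<Union>(N ` J))" "r \<in> \<Union>(N ` J)" using fJ J True assms by auto
    then have "card (\<Union>(N ` J)) = Suc (card (\<Union>(N ` J) - {r}))" by (intro card.remove)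
    moreover have "\<Union>(del_edge N j r ` J) = \<Union>(N ` J) - {r}"
      using True J assms(5) by (auto simp: Union_del_edge)
    moreover have "sum (a(j := w)) J = w + sum a (J - {j})" for w
      using sum.remove[OF fJ True, of "a(j := w)"] by (auto intro!: sum.cong)
    ultimately show ?thesis by simp
  next
    case False
    have "sum (a(j := w)) J = sum a J" for w using False by (auto intro!: sum.cong)
    then show ?thesis using False by (simp add: Union_del_edge)
  qed
  then show ?thesis unfolding hall_def by simp
qed

lemma hall_zero_iff:
  assumes "finite S" "\<And>i. i \<in> S \<Longrightarrow> finite (N i)" "a j = 0"
  shows "hall N a UNIV S \<longleftrightarrow> hall N a UNIV (S - {j})"
proof
  assume h: "hall N a UNIV (S - {j})"
  show "hall N a UNIV S"
    unfolding hall_def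
  proof (intro allI impI)
    fix J assume J: "J \<subseteq> S"
    have fJ: "finite J" using J assms finite_subset by blast
    have "sum a J = sum a (J - {j})" by (rule sum.mono_neutral_right) (use fJ assms in auto)
    also have "\<dots> \<le> card (\<Union>(N ` (J - {j})) \<inter> UNIV)" using h J unfolding hall_def by blast
    also have "\<dots> \<le> card (\<Union>(N ` J) \<inter> UNIV)" using fJ J assms by (intro card_mono) auto
    finally show "sum a J \<le> card (\<Union>(N ` J) \<inter> UNIV)" .
  qed
qed (auto intro: hall_subset)

text \<open>Lowering the value at \<open>j\<close> by one compensates for the loss of
  \<open>r\<close>. If the value stays positive, the result is a sequence with support
  \<open>S\<close> for the deleted graph; if it becomes \<open>0\<close>, then \<open>j\<close>
  leaves the support.\<close>

lemma pos_draconian_pendant: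
  assumes "finite S" "\<And>i. i \<in> S \<Longrightarrow> finite (N i)" "j \<in> S" "r \<in> N j" "r \<notin> \<Union>(N ` (S - {j}))"
  shows "card (pos_draconian S N) = card (pos_draconian S (del_edge N j r)) + card (pos_draconian (S - {j}) N)"
proof -
  let ?N = "del_edge N j r"
  have finN: "\<And>i. i \<in> S \<Longrightarrow> finite (?N i)" using assms by (auto simp: del_edge_def)
  have zero: "hall ?N a UNIV S \<longleftrightarrow> hall N a UNIV (S - {j})" if "a j = 0" for a
  proof -
    have "hall ?N a UNIV S \<longleftrightarrow> hall ?N a UNIV (S - {j})" using assms(1) finN that by (rule hall_zero_iff)
    also have "\<dots> \<longleftrightarrow> hall N a UNIV (S - {j})" by (rule hall_cong) (auto simp: del_edge_def)
    finally show ?thesis .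
  qed
  have "bij_betw (\<lambda>a. a(j := a j - 1)) (pos_draconian S N)
      (pos_draconian S ?N \<union> pos_draconian (S - {j}) N)"
  proof (rule bij_betw_byWitness[where f' = "\<lambda>a. a(j := Suc (a j))"])
    show "\<forall>a\<in>pos_draconian S N. (a(j := a j - 1))(j := Suc ((a(j := a j - 1)) j)) = a"
      using assms(3) by (auto simp: pos_draconian_def fun_eq_iff)
    show "(\<lambda>a. a(j := a j - 1)) ` pos_draconian S N \<subseteq> pos_draconian S ?N \<union> pos_draconian (S - {j}) N"
    proof safe
      fix a assume a: "a \<in> pos_draconian S N" and n: "a(j := a j - 1) \<notin> pos_draconian (S - {j}) N"
      have pos: "{i. 0 < a i} = S" and h: "hall N a UNIV S" using a by (auto simp: pos_draconian_def)
      \<comment> \<open>Since \<open>j\<close> is in the support, the truncated subtraction loses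
        nothing.\<close>
      have aj: "a j = Suc (a j - 1)" using pos assms(3) by auto
      have "hall N (a(j := Suc (a j - 1))) UNIV S" using h aj by (metis fun_upd_triv)
      then have h': "hall ?N (a(j := a j - 1)) UNIV S" by (simp only: hall_pendant_Suc_iff[OF assms])
      show "a(j := a j - 1) \<in> pos_draconian S ?N"
      proof (cases "a j = 1")
        case True
        then have "a(j := a j - 1) \<in> pos_draconian (S - {j}) N"
          using h' pos zero[of "a(j := a j - 1)"] by (auto simp: pos_draconian_def)
        with n show ?thesis by simp
      next
        case False
        then show ?thesis using h' pos aj by (auto simp: pos_draconian_def)
      qed
    qed
    show "(\<lambda>a. a(j := Suc (a j))) ` (pos_draconian S ?N \<union> pos_draconian (S - {j}) N) \<subseteq> pos_draconian S N"
    proof safe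
      fix a assume "a \<in> pos_draconian S ?N"
      then show "a(j := Suc (a j)) \<in> pos_draconian S N"
        using assms(3) hall_pendant_Suc_iff[OF assms, of a "a j"] by (auto simp: pos_draconian_def)
    next
      fix a assume a: "a \<in> pos_draconian (S - {j}) N"
      then have supp: "{i. 0 < a i} = S - {j}" and h: "hall N a UNIV (S - {j})"
        by (auto simp: pos_draconian_def)
      have "j \<notin> {i. 0 < a i}" unfolding supp by simp
      then have "a j = 0" by simp
      then have "hall ?N a UNIV S" using zero[of a] h by blast
      then have "hall N (a(j := Suc (a j))) UNIV S"
        using hall_pendant_Suc_iff[OF assms, of a "a j"] by (simp only: fun_upd_triv)
      moreover have "{i. 0 < (a(j := Suc (a j))) i} = S" using supp assms(3) by auto
      ultimately show "a(j := Suc (a j)) \<in> pos_draconian S N" by (simp add: pos_draconian_def)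
    qed
  qed auto
  then have "card (pos_draconian S N) = card (pos_draconian S ?N \<union> pos_draconian (S - {j}) N)"
    by (rule bij_betw_same_card)
  also have "\<dots> = card (pos_draconian S ?N) + card (pos_draconian (S - {j}) N)"
    using assms finN by (intro card_Un_disjoint finite_pos_draconian) (auto simp: pos_draconian_def)
  finally show ?thesis .
qed

text \<open>The sequences lost by the deletion are sorted by their unique minimal tight set
  \<open>J\<close> containing \<open>j\<close>. Tightness of \<open>J\<close> makes the values on
  \<open>J\<close> and on \<open>S - J\<close> independent of each other, which gives the
  product.\<close>

lemma pos_draconian_split:
  assumes "finite S" "\<And>i. i \<in> S \<Longrightarrow> finite (N i)" "j \<in> S" "r \<in> N j"
  shows "card (pos_draconian S N) = card (pos_draconian S (del_edge N j r)) +
    (\<Sum>J | J \<subseteq> S \<and> j \<in> J \<and> r \<notin> \<Union>(N ` (J - {j})).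
      card {a \<in> pos_draconian J N. min_tight N a UNIV j J} * card (pos_draconian (S - J) (contract N J)))"
proof -
  let ?N = "del_edge N j r" and ?I = "{J. J \<subseteq> S \<and> j \<in> J \<and> r \<notin> \<Union>(N ` (J - {j}))}"
  let ?B = "\<lambda>J. {a \<in> pos_draconian S N. min_tight N a UNIV j J}"
  have fin: "finite (pos_draconian S N)" using assms by (intro finite_pos_draconian)
  have sub: "pos_draconian S ?N \<subseteq> pos_draconian S N"
    using hall_del_edge_imp[where N = N, OF assms(2) assms(1)] by (auto simp: pos_draconian_def)
  have "a \<in> pos_draconian S N - pos_draconian S ?N \<longleftrightarrow> a \<in> (\<Union>J\<in>?I. ?B J)" for a
  proof (cases "a \<in> pos_draconian S N")
    case True
    then have "hall N a UNIV S" by (simp add: pos_draconian_def)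
    from not_hall_del_edge_iff[where N = N, OF assms(1,2) this assms(4)] True show ?thesis
      by (auto simp: pos_draconian_def min_tight_def)
  qed auto
  then have "pos_draconian S N - pos_draconian S ?N = (\<Union>J\<in>?I. ?B J)" by blast
  moreover have "card (\<Union>J\<in>?I. ?B J) = (\<Sum>J\<in>?I. card (?B J))"
  proof (rule card_UN_disjoint)
    show "\<forall>J\<in>?I. \<forall>K\<in>?I. J \<noteq> K \<longrightarrow> ?B J \<inter> ?B K = {}"
    proof (intro ballI impI equals0I)
      fix J K x assume *: "J \<in> ?I" "K \<in> ?I" "J \<noteq> K" "x \<in> ?B J \<inter> ?B K"
      have "J = K"
        by (rule min_tight_unique[where N = N and a = "x" and T = UNIV and j = j, OF assms(1,2)])
          (use * in \<open>simp_all add: pos_draconian_def\<close>)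
      with *(3) show False ..
    qed
  qed (use assms(1) fin in auto)
  moreover have "card (?B J) = card {a \<in> pos_draconian J N. min_tight N a UNIV j J}
      * card (pos_draconian (S - J) (contract N J))" if J: "J \<in> ?I" for J
  proof -
    let ?L = "{a \<in> pos_draconian J N. min_tight N a UNIV j J}"
    let ?R = "pos_draconian (S - J) (contract N J)"
    \<comment> \<open>Each half is padded with \<open>0\<close>, as functions in
      \<open>pos_draconian\<close> vanish off their support; \<open>?g\<close> glues the halves
      together again.\<close>
    let ?f = "\<lambda>a. ((\<lambda>i. if i \<in> J then a i else 0), (\<lambda>i. if i \<in> J then 0 else a i))"
    let ?g = "\<lambda>(b, c) i. if i \<in> J then b i else c i"
    have "bij_betw ?f (?B J) (?L \<times> ?R)"
    proof (rule bij_betw_byWitness[where f' = ?g])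
      show "\<forall>p\<in>?L \<times> ?R. ?f (?g p) = p"
        by (auto simp: fun_eq_iff dest: pos_draconianD(3))
      show "?f ` ?B J \<subseteq> ?L \<times> ?R"
      proof safe
        fix a assume a: "a \<in> pos_draconian S N" and t: "min_tight N a UNIV j J"
        note pos = pos_draconianD(1)[OF a] and h = pos_draconianD(2)[OF a]
        have "hall N a UNIV J" "hall (contract N J) a UNIV (S - J)"
          using hall_contract_iff[where N = N, OF assms(1,2), where J = J and a = a and T = UNIV] h t J
          by (auto simp: min_tight_def)
        moreover have "hall N a UNIV J \<longleftrightarrow> hall N (\<lambda>i. if i \<in> J then a i else 0) UNIV J"
          by (rule hall_cong) auto
        moreover have "hall (contract N J) a UNIV (S - J)
            \<longleftrightarrow> hall (contract N J) (\<lambda>i. if i \<in> J then 0 else a i) UNIV (S - J)"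
          by (rule hall_cong) auto
        ultimately show "(\<lambda>i. if i \<in> J then a i else 0) \<in> pos_draconian J N"
          "(\<lambda>i. if i \<in> J then 0 else a i) \<in> ?R"
          using pos J by (auto simp: pos_draconian_def split: if_splits)
        \<comment> \<open>Minimal tightness involves subsets of \<open>J\<close> only, hence only
          the half on \<open>J\<close>.\<close>
        have "min_tight N a UNIV j J \<longleftrightarrow> min_tight N (\<lambda>i. if i \<in> J then a i else 0) UNIV j J"
          by (rule min_tight_cong) auto
        with t show "min_tight N (\<lambda>i. if i \<in> J then a i else 0) UNIV j J" by simp
      qed
      show "?g ` (?L \<times> ?R) \<subseteq> ?B J"
      proof clarify
        fix b c assume b: "b \<in> pos_draconian J N" "min_tight N b UNIV j J" and c: "c \<in> ?R"
        let ?a = "\<lambda>i. if i \<in> J then b i else c i"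
        have "min_tight N b UNIV j J \<longleftrightarrow> min_tight N ?a UNIV j J"
          by (rule min_tight_cong) auto
        then have t: "min_tight N ?a UNIV j J" using b by simp
        have "hall N b UNIV J \<longleftrightarrow> hall N ?a UNIV J" by (rule hall_cong) auto
        moreover have "hall (contract N J) c UNIV (S - J) \<longleftrightarrow> hall (contract N J) ?a UNIV (S - J)"
          by (rule hall_cong) auto
        ultimately have "hall N ?a UNIV S"
          using hall_contract_iff[where N = N, OF assms(1,2), where J = J and a = ?a and T = UNIV] t J b c
          by (auto simp: min_tight_def pos_draconian_def)
        moreover have "{i. 0 < ?a i} = S"
          using pos_draconianD(1)[OF b(1)] pos_draconianD(1)[OF c] J by (auto simp: set_eq_iff)
        ultimately show "?a \<in> pos_draconian S N \<and> min_tight N ?a UNIV j J"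
          using t by (simp add: pos_draconian_def)
      qed
    qed auto
    then show ?thesis by (simp add: bij_betw_same_card card_cartesian_product)
  qed
  moreover have "card (pos_draconian S N) = card (pos_draconian S ?N) + card (pos_draconian S N - pos_draconian S ?N)"
    using fin sub by (simp add: card_Diff_subset card_mono finite_subset)
  ultimately show ?thesis by simp
qed

lemma edge_recursive_pos_draconian:
  "edge_recursive (\<lambda>S N. card (pos_draconian S N))
    (\<lambda>N j r J. card {a \<in> pos_draconian J N. min_tight N a UNIV j J})"
proof
  fix N :: "'a \<Rightarrow> 'b set"
  have "pos_draconian {} N = {\<lambda>_. 0}" by (auto simp: pos_draconian_def hall_def)
  then show "card (pos_draconian {} N) = 1" by simp
next
  fix S :: "'a set" and i and N :: "'a \<Rightarrow> 'b set"
  assume i: "i \<in> S" "N i = {}"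
  have "\<not> hall N a UNIV S" if "0 < a i" for a
    using i that unfolding hall_def by (auto intro!: exI[of _ "{i}"])
  with i have "pos_draconian S N = {}" by (auto simp: pos_draconian_def)
  then show "card (pos_draconian S N) = 0" by simp
qed (fact pos_draconian_pendant pos_draconian_split)+

section \<open>Matchable sets\<close>

text \<open>The sets \<open>T\<close> are sorted by whether they contain \<open>r\<close>. Those
  that do not never see the edge \<open>jr\<close>. In those that do, \<open>r\<close> can only be
  matched to \<open>j\<close>, and removing both leaves a set matched to
  \<open>S - {j}\<close>.\<close>

lemma matchable_pendant:
  assumes "finite S" "\<And>i. i \<in> S \<Longrightarrow> finite (N i)" "j \<in> S" "r \<in> N j" "r \<notin> \<Union>(N ` (S - {j}))"
  shows "card (matchable S N) = card (matchable S (del_edge N j r)) + card (matchable (S - {j}) N)"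
proof -
  let ?N = "del_edge N j r"
  have finN: "\<And>i. i \<in> S \<Longrightarrow> finite (?N i)" using assms by (auto simp: del_edge_def)
  have UN: "\<Union>(?N ` S) = \<Union>(N ` S) - {r}" using assms by (simp add: Union_del_edge)
  have finT: "finite T" if "T \<subseteq> \<Union>(N ` S)" for T
    using that by (rule finite_subset) (use assms in auto)
  have not_r: "{T \<in> matchable S N. r \<notin> T} = matchable S ?N"
  proof -
    have "hall N (\<lambda>_. 1) T S \<longleftrightarrow> hall ?N (\<lambda>_. 1) T S" if "r \<notin> T" for T
      by (rule hall_cong) (use that in \<open>auto simp: del_edge_def\<close>)
    then have "T \<in> {T \<in> matchable S N. r \<notin> T} \<longleftrightarrow> T \<in> matchable S ?N" for T
      using UN by (cases "r \<in> T") (auto simp: matchable_def)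
    then show ?thesis by blast
  qed
  have "bij_betw (insert r) (matchable (S - {j}) N) {T \<in> matchable S N. r \<in> T}"
  proof (rule bij_betw_byWitness[where f' = "\<lambda>T. T - {r}"])
    show "\<forall>U\<in>matchable (S - {j}) N. insert r U - {r} = U"
      using assms(5) by (auto simp: matchable_def)
    show "insert r ` matchable (S - {j}) N \<subseteq> {T \<in> matchable S N. r \<in> T}"
    proof clarify
      fix U assume "U \<in> matchable (S - {j}) N"
      then have U: "U \<subseteq> \<Union>(N ` (S - {j}))" "card U = card (S - {j})" "hall N (\<lambda>_. 1) U (S - {j})"
        by (auto simp: matchable_def)
      have fU: "finite U" using U by (intro finT) auto
      have "r \<notin> U" using U(1) assms(5) by blast
      then have "card (insert r U) = card S"
        using U(2) fU card_Suc_Diff1[OF assms(1,3)] by simp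
      moreover have "hall N (\<lambda>_. 1) (insert r U) S"
        unfolding hall_def
      proof (intro allI impI)
        fix J assume J: "J \<subseteq> S"
        have fJ: "finite J" using J assms finite_subset by blast
        have fin: "finite (\<Union>(N ` J) \<inter> insert r U)" using fU by simp
        have h: "card (J - {j}) \<le> card (\<Union>(N ` (J - {j})) \<inter> U)"
          using U(3)[unfolded hall_def, rule_format, OF Diff_mono[OF J subset_refl]] by simp
        show "(\<Sum>_\<in>J. 1) \<le> card (\<Union>(N ` J) \<inter> insert r U)"
        proof (cases "j \<in> J")
          case True
          have "card J = Suc (card (J - {j}))" using True fJ by (intro card.remove)
          also have "\<dots> \<le> Suc (card (\<Union>(N ` (J - {j})) \<inter> U))" using h by simp
          also have "\<dots> = card (insert r (\<Union>(N ` (J - {j})) \<inter> U))"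
            using fU U(1) assms(5) by (subst card_insert_disjoint) auto
          also have "\<dots> \<le> card (\<Union>(N ` J) \<inter> insert r U)"
            using fin True assms(4) by (intro card_mono) auto
          finally show ?thesis by simp
        next
          case False
          then have "card J \<le> card (\<Union>(N ` J) \<inter> U)" using h by simp
          also have "\<dots> \<le> card (\<Union>(N ` J) \<inter> insert r U)" using fin by (intro card_mono) auto
          finally show ?thesis by simp
        qed
      qed
      moreover have "insert r U \<subseteq> \<Union>(N ` S)" using U(1) assms(3,4) by blast
      ultimately show "insert r U \<in> matchable S N \<and> r \<in> insert r U" by (simp add: matchable_def)
    qed
    show "(\<lambda>T. T - {r}) ` {T \<in> matchable S N. r \<in> T} \<subseteq> matchable (S - {j}) N"
    proof clarify
      fix T assume "T \<in> matchable S N" and r: "r \<in> T"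
      then have T: "T \<subseteq> \<Union>(N ` S)" "card T = card S" "hall N (\<lambda>_. 1) T S"
        by (auto simp: matchable_def)
      have fT: "finite T" using T by (intro finT) auto
      have c: "card (T - {r}) = card (S - {j})" using T r assms by simp
      have "hall N (\<lambda>_. 1) T (S - {j})" using T(3) by (rule hall_subset) auto
      moreover have "hall N (\<lambda>_. 1) T (S - {j}) \<longleftrightarrow> hall N (\<lambda>_. 1) (T - {r}) (S - {j})"
        by (rule hall_cong) (use assms(5) in auto)
      ultimately have h: "hall N (\<lambda>_. 1) (T - {r}) (S - {j})" by simp
      \<comment> \<open>Hall's inequality for all of \<open>S - {j}\<close>, together with equal
        cardinalities, forces every element of \<open>T - {r}\<close> to be a neighbour of
        \<open>S - {j}\<close>.\<close>
      then have "card (T - {r}) \<le> card (\<Union>(N ` (S - {j})) \<inter> (T - {r}))"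
        using c unfolding hall_def by (metis card_eq_sum subset_refl)
      then have "\<Union>(N ` (S - {j})) \<inter> (T - {r}) = T - {r}"
        using fT by (intro card_seteq) auto
      then show "T - {r} \<in> matchable (S - {j}) N"
        using c h unfolding matchable_def by blast
    qed
  qed auto
  then have "card {T \<in> matchable S N. r \<in> T} = card (matchable (S - {j}) N)"
    by (simp add: bij_betw_same_card)
  moreover have "card (matchable S N) = card ({T \<in> matchable S N. r \<notin> T} \<union> {T \<in> matchable S N. r \<in> T})"
    by (rule arg_cong[where f = card]) auto
  moreover have "\<dots> = card {T \<in> matchable S N. r \<notin> T} + card {T \<in> matchable S N. r \<in> T}"
    using finite_matchable[OF assms(1,2)] by (intro card_Un_disjoint) auto
  ultimately show ?thesis using not_r by simp
qed

text \<open>Parallel to the case of sequences, with demand \<open>1\<close> at every index: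
  \<open>T\<close> is cut into its neighbours of \<open>J\<close> and the rest. The weight records
  \<open>r \<in> T\<close>, since a set avoiding \<open>r\<close> survives the deletion.\<close>

lemma matchable_split:
  assumes "finite S" "\<And>i. i \<in> S \<Longrightarrow> finite (N i)" "j \<in> S" "r \<in> N j"
  shows "card (matchable S N) = card (matchable S (del_edge N j r)) +
    (\<Sum>J | J \<subseteq> S \<and> j \<in> J \<and> r \<notin> \<Union>(N ` (J - {j})).
      card {T \<in> matchable J N. r \<in> T \<and> min_tight N (\<lambda>_. 1) T j J} * card (matchable (S - J) (contract N J)))"
proof -
  let ?N = "del_edge N j r" and ?I = "{J. J \<subseteq> S \<and> j \<in> J \<and> r \<notin> \<Union>(N ` (J - {j}))}"
  let ?B = "\<lambda>J. {T \<in> matchable S N. r \<in> T \<and> min_tight N (\<lambda>_. 1) T j J}"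
  have fin: "finite (matchable S N)" using assms by (intro finite_matchable)
  have finT: "finite T" if "T \<subseteq> \<Union>(N ` S)" for T
    using that by (rule finite_subset) (use assms in auto)
  \<comment> \<open>Hall's inequality for \<open>S\<close> and the cardinality of \<open>T\<close>
    already place \<open>T\<close> among the neighbours in \<open>M\<close>, so the sets lost by the
    deletion are lost through Hall's condition alone.\<close>
  have mat: "T \<in> matchable S M \<longleftrightarrow> T \<subseteq> \<Union>(N ` S) \<and> card T = card S \<and> hall M (\<lambda>_. 1) T S"
    if M: "\<And>i. M i \<subseteq> N i" for M T
  proof -
    have "T \<subseteq> \<Union>(M ` S)" if T: "T \<subseteq> \<Union>(N ` S)" "card T = card S" "hall M (\<lambda>_. 1) T S"
    proof -
      have "card T \<le> card (\<Union>(M ` S) \<inter> T)" using T(2,3) by (auto simp: hall_def)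
      then have "\<Union>(M ` S) \<inter> T = T" using finT[OF T(1)] by (intro card_seteq) auto
      then show ?thesis by blast
    qed
    moreover have "\<Union>(M ` S) \<subseteq> \<Union>(N ` S)" using M by blast
    ultimately show ?thesis unfolding matchable_def by blast
  qed
  have matN: "T \<in> matchable S ?N \<longleftrightarrow> T \<subseteq> \<Union>(N ` S) \<and> card T = card S \<and> hall ?N (\<lambda>_. 1) T S" for T
    by (rule mat) (auto simp: del_edge_def)
  have sub: "matchable S ?N \<subseteq> matchable S N"
    using hall_del_edge_imp[where N = N, OF assms(2) assms(1)] matN by (auto simp: matchable_def)
  have "T \<in> matchable S N - matchable S ?N \<longleftrightarrow> T \<in> (\<Union>J\<in>?I. ?B J)" for T
  proof (cases "T \<in> matchable S N")
    case True
    then have "hall N (\<lambda>_. 1) T S" by (simp add: matchable_def)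
    from not_hall_del_edge_iff[where N = N, OF assms(1,2) this assms(4)] True show ?thesis
      unfolding matN Diff_iff by (auto simp: matchable_def min_tight_def)
  qed auto
  then have "matchable S N - matchable S ?N = (\<Union>J\<in>?I. ?B J)" by blast
  moreover have "card (\<Union>J\<in>?I. ?B J) = (\<Sum>J\<in>?I. card (?B J))"
  proof (rule card_UN_disjoint)
    show "\<forall>J\<in>?I. \<forall>K\<in>?I. J \<noteq> K \<longrightarrow> ?B J \<inter> ?B K = {}"
    proof (intro ballI impI equals0I)
      fix J K x assume *: "J \<in> ?I" "K \<in> ?I" "J \<noteq> K" "x \<in> ?B J \<inter> ?B K"
      have "J = K"
        by (rule min_tight_unique[where N = N and a = "\<lambda>_. 1" and T = x and j = j, OF assms(1,2)])
          (use * in \<open>simp_all add: matchable_def\<close>)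
      with *(3) show False ..
    qed
  qed (use assms(1) fin in auto)
  moreover have "card (?B J) = card {T \<in> matchable J N. r \<in> T \<and> min_tight N (\<lambda>_. 1) T j J}
      * card (matchable (S - J) (contract N J))" if J: "J \<in> ?I" for J
  proof -
    let ?L = "{T \<in> matchable J N. r \<in> T \<and> min_tight N (\<lambda>_. 1) T j J}"
    let ?R = "matchable (S - J) (contract N J)"
    let ?U = "\<Union>(N ` J)"
    have JS: "J \<subseteq> S" "finite J" using J assms finite_subset by auto
    have rU: "r \<in> ?U" using J assms by auto
    have "bij_betw (\<lambda>T. (T \<inter> ?U, T - ?U)) (?B J) (?L \<times> ?R)"
    proof (rule bij_betw_byWitness[where f' = "\<lambda>(U, V). U \<union> V"])
      show "\<forall>p\<in>?L \<times> ?R. (\<lambda>T. (T \<inter> ?U, T - ?U)) ((\<lambda>(U, V). U \<union> V) p) = p"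
        by (auto simp: matchable_def contract_def)
      show "(\<lambda>T. (T \<inter> ?U, T - ?U)) ` ?B J \<subseteq> ?L \<times> ?R"
      proof (intro subsetI, elim imageE, simp only: mem_Times_iff fst_conv snd_conv)
        fix T assume "T \<in> ?B J"
        then have T: "T \<subseteq> \<Union>(N ` S)" "card T = card S" "hall N (\<lambda>_. 1) T S" "r \<in> T"
          and t: "min_tight N (\<lambda>_. 1) T j J" by (auto simp: matchable_def)
        have fT: "finite T" using T(1) by (rule finT)
        have h: "hall N (\<lambda>_. 1) T J" "hall (contract N J) (\<lambda>_. 1) T (S - J)"
          using hall_contract_iff[where N = N, OF assms(1,2), where J = J and a = "\<lambda>_. 1" and T = T] T t J
          by (auto simp: min_tight_def)
        have "hall N (\<lambda>_. 1) T J \<longleftrightarrow> hall N (\<lambda>_. 1) (T \<inter> ?U) J" by (rule hall_cong) auto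
        moreover have "min_tight N (\<lambda>_. 1) T j J \<longleftrightarrow> min_tight N (\<lambda>_. 1) (T \<inter> ?U) j J"
          by (rule min_tight_cong) auto
        \<comment> \<open>With demand \<open>1\<close>, tightness of \<open>J\<close> says precisely
          that this half has the right size.\<close>
        moreover have c: "card (T \<inter> ?U) = card J" using t by (simp add: min_tight_def tight_def Int_commute)
        ultimately have "T \<inter> ?U \<in> ?L" using h t T rU by (auto simp: matchable_def)
        moreover have "hall (contract N J) (\<lambda>_. 1) T (S - J)
            \<longleftrightarrow> hall (contract N J) (\<lambda>_. 1) (T - ?U) (S - J)"
          by (rule hall_cong) (auto simp: contract_def)
        moreover have "card (T - ?U) = card (S - J)"
          using T(2) c card_Int_Diff[OF fT, of ?U] card_Int_Diff[OF assms(1), of J]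
          by (simp add: Int_absorb1[OF JS(1)])
        moreover have "T - ?U \<subseteq> \<Union>(contract N J ` (S - J))" using T(1) by (auto simp: contract_def)
        ultimately show "T \<inter> ?U \<in> ?L \<and> T - ?U \<in> ?R" using h by (auto simp: matchable_def)
      qed
      show "(\<lambda>(U, V). U \<union> V) ` (?L \<times> ?R) \<subseteq> ?B J"
      proof clarify
        fix U V assume U: "U \<in> matchable J N" "min_tight N (\<lambda>_. 1) U j J" "r \<in> U" and V: "V \<in> ?R"
        have sub: "U \<subseteq> ?U" "V \<subseteq> \<Union>(N ` S) - ?U" using U V by (auto simp: matchable_def contract_def)
        have "?U \<subseteq> \<Union>(N ` S)" using JS(1) by (intro UN_mono) auto
        then have UV: "U \<subseteq> \<Union>(N ` S)" "V \<subseteq> \<Union>(N ` S)"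
          by (rule order_trans[OF sub(1)], intro order_trans[OF sub(2)] Diff_subset)
        have fUV: "finite U" "finite V" by (rule finT[OF UV(1)], rule finT[OF UV(2)])
        have "min_tight N (\<lambda>_. 1) U j J \<longleftrightarrow> min_tight N (\<lambda>_. 1) (U \<union> V) j J"
          by (rule min_tight_cong) (use sub in auto)
        then have t: "min_tight N (\<lambda>_. 1) (U \<union> V) j J" using U by simp
        have "hall N (\<lambda>_. 1) U J \<longleftrightarrow> hall N (\<lambda>_. 1) (U \<union> V) J"
          by (rule hall_cong) (use sub in auto)
        moreover have "hall (contract N J) (\<lambda>_. 1) V (S - J)
            \<longleftrightarrow> hall (contract N J) (\<lambda>_. 1) (U \<union> V) (S - J)"
          by (rule hall_cong) (use sub in \<open>auto simp: contract_def\<close>)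
        ultimately have "hall N (\<lambda>_. 1) (U \<union> V) S"
          using hall_contract_iff[where N = N, OF assms(1,2), where J = J and a = "\<lambda>_. 1" and T = "U \<union> V"] t J U V
          by (auto simp: min_tight_def matchable_def)
        moreover have "card (U \<union> V) = card S"
        proof -
          have "card (U \<union> V) = card U + card V" using fUV sub by (intro card_Un_disjoint) auto
          also have "\<dots> = card J + card (S - J)" using U V by (simp add: matchable_def)
          also have "\<dots> = card S" using JS assms(1) by (simp add: card_Diff_subset card_mono)
          finally show ?thesis .
        qed
        ultimately show "U \<union> V \<in> matchable S N \<and> r \<in> U \<union> V \<and> min_tight N (\<lambda>_. 1) (U \<union> V) j J"
          using t UV U(3) by (simp add: matchable_def)
      qed
    qed auto
    then show ?thesis by (simp add: bij_betw_same_card card_cartesian_product)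
  qed
  moreover have "card (matchable S N) = card (matchable S ?N) + card (matchable S N - matchable S ?N)"
    using fin sub by (simp add: card_Diff_subset card_mono finite_subset)
  ultimately show ?thesis by simp
qed

lemma edge_recursive_matchable:
  "edge_recursive (\<lambda>S N. card (matchable S N))
    (\<lambda>N j r J. card {T \<in> matchable J N. r \<in> T \<and> min_tight N (\<lambda>_. 1) T j J})"
proof
  fix N :: "'a \<Rightarrow> 'b set"
  have "matchable {} N = {{}}" by (auto simp: matchable_def hall_def)
  then show "card (matchable {} N) = 1" by simp
next
  fix S :: "'a set" and i and N :: "'a \<Rightarrow> 'b set"
  assume i: "i \<in> S" "N i = {}"
  have "\<not> hall N (\<lambda>_. 1) T S" for T
    using i unfolding hall_def by (auto intro!: exI[of _ "{i}"])
  then have "matchable S N = {}" by (auto simp: matchable_def)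
  then show "card (matchable S N) = 0" by simp
qed (fact matchable_pendant matchable_split)+

text \<open>Both counts are edge recursive, each with its own weights, and uniqueness does not
  require the weights to be compared beforehand.\<close>

lemma card_pos_draconian:
  assumes "finite S" "\<And>i. i \<in> S \<Longrightarrow> finite (N i)"
  shows "card (pos_draconian S N) = card (matchable S N)"
  using edge_recursive_unique[OF edge_recursive_pos_draconian edge_recursive_matchable assms] .

text \<open>Hall's condition for \<open>K \<subseteq> T\<close> is the one for the complement in \<open>S\<close> of the neighbours of \<open>K\<close>.\<close>

lemma matchable_converse:
  assumes "finite S" "finite T" "T \<in> matchable S (\<lambda>i. {r. (i, r) \<in> E})"
  shows "S \<in> matchable T (\<lambda>r. {i. (i, r) \<in> E})"
proof -
  let ?N = "\<lambda>i. {r. (i, r) \<in> E}" and ?M = "\<lambda>r. {i. (i, r) \<in> E}"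
  have c: "card T = card S" and h: "hall ?N (\<lambda>_. 1) T S" using assms by (auto simp: matchable_def)
  have h': "card K \<le> card (\<Union>(?M ` K) \<inter> S)" if K: "K \<subseteq> T" for K
  proof -
    have fK: "finite K" using K assms finite_subset by blast
    \<comment> \<open>The indices with no neighbour in \<open>K\<close> have all their neighbours in
      \<open>T\<close> outside \<open>K\<close>, so there are at most \<open>card T - card K\<close>
      of them.\<close>
    have "card (S - \<Union>(?M ` K)) \<le> card (\<Union>(?N ` (S - \<Union>(?M ` K))) \<inter> T)"
      using h unfolding hall_def by (auto dest: spec[of _ "S - \<Union>(?M ` K)"])
    also have "\<dots> \<le> card (T - K)" using assms by (intro card_mono) auto
    also have "\<dots> = card T - card K" using fK K by (rule card_Diff_subset)
    finally have "card (S - \<Union>(?M ` K)) \<le> card T - card K" .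
    moreover have "card S = card (S \<inter> \<Union>(?M ` K)) + card (S - \<Union>(?M ` K))"
      using assms(1) by (metis card_Int_Diff)
    moreover have "card K \<le> card T" using K assms by (intro card_mono)
    ultimately show ?thesis using c by (simp add: Int_commute)
  qed
  \<comment> \<open>The case \<open>K = T\<close> of the dual condition, with equal cardinalities,
    shows that each index in \<open>S\<close> has a neighbour in \<open>T\<close>.\<close>
  have "\<Union>(?M ` T) \<inter> S = S" using h'[of T] c assms(1) by (intro card_seteq) auto
  then show ?thesis using h' c unfolding matchable_def hall_def by auto
qed

section \<open>Symmetry of the support enumerator\<close>

lemma finite_right_nbrs: "finite (right_nbrs G j)"
  by (auto simp: right_nbrs_def)

lemma right_nbrs_eq: "bipartite_graph G \<Longrightarrow> right_nbrs G = (\<lambda>i. {r. (i, r) \<in> edges G})"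
  by (auto simp: right_nbrs_def bipartite_graph_def fun_eq_iff)

lemma right_nbrs_dual_eq:
  "bipartite_graph G \<Longrightarrow> right_nbrs (dual_graph G) = (\<lambda>r. {i. (i, r) \<in> edges G})"
  by (auto simp: right_nbrs_def bipartite_graph_def dual_graph_def fun_eq_iff)

text \<open>The two encodings differ only off the support: undefined values outside the left vertex
  set become \<open>0\<close>. Hall's condition on \<open>S\<close> suffices for all index sets,
  because indices outside \<open>S\<close> add nothing to the sum and can only enlarge the
  neighbourhood.\<close>

lemma card_draconian_support:
  assumes S: "S \<subseteq> {1..num_left G}"
  shows "card {a \<in> draconian G. {i \<in> {1..num_left G}. 0 < a i} = S} = card (pos_draconian S (right_nbrs G))"
proof (rule bij_betw_same_card)
  let ?m = "{1..num_left G}" and ?N = "right_nbrs G"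
  let ?f = "\<lambda>a i. if i \<in> ?m then a i else (0::nat)"
  show "bij_betw ?f {a \<in> draconian G. {i \<in> ?m. 0 < a i} = S} (pos_draconian S ?N)"
  proof (rule bij_betw_byWitness[where f' = "\<lambda>a. restrict a ?m"])
    show "\<forall>a\<in>{a \<in> draconian G. {i \<in> ?m. 0 < a i} = S}. restrict (?f a) ?m = a"
      by (auto simp: draconian_def fun_eq_iff PiE_def extensional_def restrict_def)
    show "\<forall>a\<in>pos_draconian S ?N. ?f (restrict a ?m) = a"
      using S by (auto simp: pos_draconian_def fun_eq_iff)
    show "?f ` {a \<in> draconian G. {i \<in> ?m. 0 < a i} = S} \<subseteq> pos_draconian S ?N"
    proof clarify
      fix a assume a: "a \<in> draconian G" and supp: "S = {i \<in> ?m. 0 < a i}"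
      have "hall ?N (?f a) UNIV S"
        unfolding hall_def
      proof (intro allI impI)
        fix J assume J: "J \<subseteq> S"
        have "sum (?f a) J = sum a J" using J S by (intro sum.cong) auto
        \<comment> \<open>The empty set is treated apart, as the draconian condition speaks of
          nonempty sets only.\<close>
        also have "\<dots> \<le> card (\<Union>(?N ` J))"
          using a J S by (cases "J = {}") (auto simp: draconian_def)
        finally show "sum (?f a) J \<le> card (\<Union>(?N ` J) \<inter> UNIV)" by simp
      qed
      then show "?f a \<in> pos_draconian {i \<in> ?m. 0 < a i} ?N"
        unfolding supp pos_draconian_def by auto
    qed
    show "(\<lambda>a. restrict a ?m) ` pos_draconian S ?N \<subseteq> {a \<in> draconian G. {i \<in> ?m. 0 < a i} = S}"
    proof (rule image_subsetI)
      fix a assume "a \<in> pos_draconian S ?N"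
      then have supp: "{i. 0 < a i} = S" and h: "hall ?N a UNIV S" by (auto simp: pos_draconian_def)
      have "sum (restrict a ?m) J \<le> card (\<Union>(?N ` J))" if J: "J \<subseteq> ?m" for J
      proof -
        have fJ: "finite J" using J finite_subset by blast
        have "sum (restrict a ?m) J = sum a J" using J by (intro sum.cong) auto
        also have "\<dots> = sum a (J \<inter> S)"
          using fJ supp by (intro sum.mono_neutral_right) auto
        also have "\<dots> \<le> card (\<Union>(?N ` (J \<inter> S)))" using h unfolding hall_def by (auto dest: spec[of _ "J \<inter> S"])
        also have "\<dots> \<le> card (\<Union>(?N ` J))"
          using fJ finite_right_nbrs by (intro card_mono) auto
        finally show ?thesis .
      qed
      then show "restrict a ?m \<in> {a \<in> draconian G. {i \<in> ?m. 0 < a i} = S}"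
        using supp S by (auto simp: draconian_def)
    qed
  qed
qed

text \<open>Sequences are grouped by support \<open>S\<close>; each group contributes a constant
  monomial, so only its size matters, and that is the number of sets matchable to
  \<open>S\<close>.\<close>

lemma support_enumerator_eq_matchable:
  "support_enumerator G =
    (\<Sum>(S, T)\<in>Sigma (Pow {1..num_left G}) (\<lambda>S. matchable S (right_nbrs G)). monom 1 (card S))"
proof -
  let ?m = "{1..num_left G}"
  have "support_enumerator G =
      (\<Sum>S\<in>Pow ?m. \<Sum>a\<in>{a \<in> draconian G. {i \<in> ?m. 0 < a i} = S}. monom 1 (num_positive (num_left G) a))"
    unfolding support_enumerator_def
    by (rule sum.group[symmetric]) (auto simp: finite_draconian)
  also have "\<dots> = (\<Sum>S\<in>Pow ?m. \<Sum>T\<in>matchable S (right_nbrs G). monom 1 (card S))"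
  proof (rule sum.cong)
    fix S assume "S \<in> Pow ?m"
    then have S: "S \<subseteq> ?m" "finite S" using finite_subset by auto
    have "(\<Sum>a\<in>{a \<in> draconian G. {i \<in> ?m. 0 < a i} = S}. monom 1 (num_positive (num_left G) a))
        = (\<Sum>a\<in>{a \<in> draconian G. {i \<in> ?m. 0 < a i} = S}. monom (1::int) (card S))"
      by (rule sum.cong) (auto simp: num_positive_def)
    then show "(\<Sum>a\<in>{a \<in> draconian G. {i \<in> ?m. 0 < a i} = S}. monom (1::int) (num_positive (num_left G) a))
        = (\<Sum>T\<in>matchable S (right_nbrs G). monom 1 (card S))"
      using card_draconian_support[OF S(1)] card_pos_draconian[OF S(2) finite_right_nbrs] by simp
  qed simp
  also have "\<dots> = (\<Sum>(S, T)\<in>Sigma (Pow ?m) (\<lambda>S. matchable S (right_nbrs G)). monom 1 (card S))"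
    by (rule sum.Sigma) (auto intro!: finite_matchable finite_right_nbrs intro: finite_subset)
  finally show ?thesis .
qed

theorem theorem1p3:
  fixes G :: bigraph
  assumes "bipartite_graph G"
  shows "support_enumerator G = support_enumerator (dual_graph G)"
proof -
  let ?N = "right_nbrs G" and ?M = "right_nbrs (dual_graph G)"
  let ?m = "{1..num_left G}" and ?n = "{1..num_right G}"
  have NM: "?N = (\<lambda>i. {r. (i, r) \<in> edges G})" "?M = (\<lambda>r. {i. (i, r) \<in> edges G})"
    using assms by (simp_all add: right_nbrs_eq right_nbrs_dual_eq)
  have sub: "T \<subseteq> ?n" if "T \<in> matchable S ?N" for S T
    using that by (auto simp: matchable_def right_nbrs_def)
  have sub': "S \<subseteq> ?m" if "S \<in> matchable T ?M" for S T
    using that by (auto simp: matchable_def right_nbrs_def dual_graph_def)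
  have 1: "S \<in> matchable T ?M" if "S \<subseteq> ?m" "T \<in> matchable S ?N" for S T
    using matchable_converse[of S T "edges G"] that sub[OF that(2)] NM finite_subset by auto
  have 2: "T \<in> matchable S ?N" if "T \<subseteq> ?n" "S \<in> matchable T ?M" for S T
    using matchable_converse[of T S "(edges G)\<inverse>"] that sub'[OF that(2)] NM finite_subset by auto
  have "(\<Sum>(S, T)\<in>Sigma (Pow ?m) (\<lambda>S. matchable S ?N). monom (1::int) (card S))
      = (\<Sum>(T, S)\<in>Sigma (Pow ?n) (\<lambda>T. matchable T ?M). monom 1 (card T))"
  \<comment> \<open>Swapping the pair exchanges the two index sets by \<open>1\<close> and
    \<open>2\<close>, and keeps the exponent because matched sets have equal cardinality.\<close>
  proof (rule sum.reindex_bij_witness[where i = prod.swap and j = prod.swap])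
    fix p assume p: "p \<in> Sigma (Pow ?m) (\<lambda>S. matchable S ?N)"
    obtain S T where [simp]: "p = (S, T)" by fastforce
    have ST: "S \<subseteq> ?m" "T \<in> matchable S ?N" using p by simp_all
    show "prod.swap (prod.swap p) = p" by simp
    show "prod.swap p \<in> Sigma (Pow ?n) (\<lambda>T. matchable T ?M)" using sub[OF ST(2)] 1[OF ST] by simp
    show "(case prod.swap p of (T, S) \<Rightarrow> monom 1 (card T)) = (case p of (S, T) \<Rightarrow> monom (1::int) (card S))"
      using ST(2) by (simp add: matchable_def)
  next
    fix p assume p: "p \<in> Sigma (Pow ?n) (\<lambda>T. matchable T ?M)"
    obtain T S where [simp]: "p = (T, S)" by fastforce
    have TS: "T \<subseteq> ?n" "S \<in> matchable T ?M" using p by simp_all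
    show "prod.swap (prod.swap p) = p" by simp
    show "prod.swap p \<in> Sigma (Pow ?m) (\<lambda>S. matchable S ?N)" using sub'[OF TS(2)] 2[OF TS] by simp
  qed
  then show ?thesis
    by (simp add: support_enumerator_eq_matchable dual_graph_def)
qed

end
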